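(* Let $\ell\geq 1$ be an integer. If a graph $G$ has a clean binary ear tree $(T, \mathcal{P})$ such that $T$ is isomorphic (as a rooted tree) to $\Gamma_{3\ell-2}$, then $G$ contains $\Gamma_{\ell}^{+}$ or $\nabla_\ell$ as a minor.
   Context: All graphs are finite and simple. $\Gamma_m$ is the complete binary tree of height $m$ (rooted; every non-leaf vertex has two children; every root-to-leaf path has $m$ edges). $\Gamma_\ell^+$ is obtained from $\Gamma_\ell$ by adding one new vertex adjacent to all its leaves. $\nabla_1$ is a triangle with a designated root edge; $\nabla_{\ell+1}$ is obtained from two disjoint copies of $\nabla_\ell$ with root edges $e_1,e_2$ and a triangle with edges $e_1',e_2',e_3$ by identifying $e_i$ with $e_i'$ ($i=1,2$), with $e_3$ the new root edge. The length of a path is its number of edges. If $H$ is a subgraph of $G$, an $H$-ear is a path in $G$ with both ends in $V(H)$ and no internal vertex in $V(H)$. A binary tree is a rooted tree in which every vertex has at most two children; $T_x$ denotes the subtree of $T$ rooted at $x$ (consisting of $x$ and its descendants). A binary ear tree in $G$ is a pair $(T,\mathcal{P})$ where $T$ is a binary tree and $\mathcal{P}=\{P_x:x\in V(T)\}$ is a collection of paths in $G$, each of length at least $2$, such that for every non-root vertex $x$ of $T$ with parent $y$: (1) $P_x$ is a $P_y$-ear, and (2) no internal vertex of $P_x$ lies in $\bigcup_{z\in V(T)\setminus V(T_x)}V(P_z)$. It is clean if for every non-leaf vertex $y$ of $T$, some end of $P_y$ is not contained in any $P_x$ with $x$ a child of $y$. *)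

theory Defs
  imports "Graph_Theory.Graph_Theory"
begin

text \<open>
  Finite simple graphs are represented by \<^locale>\<open>pair_graph\<close>: finite, loop-free pair digraphs
  with a symmetric set of arcs; an edge \<open>uv\<close> is the pair of arcs \<open>(u,v)\<close>, \<open>(v,u)\<close>.
  A path is the list of its vertices (\<^const>\<open>vpath\<close>), its length is \<^const>\<open>vwalk_length\<close>.
\<close>

subsection \<open>Minors\<close>

text \<open>\<open>H\<close> is a minor of \<open>G\<close>: there is a model of \<open>H\<close> in \<open>G\<close>, with branch sets \<open>B u\<close>.
  Connectedness includes non-emptiness.\<close>

definition is_minor :: "'b pair_pre_digraph \<Rightarrow> 'a pair_pre_digraph \<Rightarrow> bool" where
  "is_minor H G \<longleftrightarrow>
    (\<exists>B :: 'b \<Rightarrow> 'a set.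
      (\<forall>u \<in> pverts H. B u \<subseteq> pverts G \<and> connected (with_proj G \<restriction> B u)) \<and>
      (\<forall>u \<in> pverts H. \<forall>v \<in> pverts H. u \<noteq> v \<longrightarrow> B u \<inter> B v = {}) \<and>
      (\<forall>(u, v) \<in> parcs H. \<exists>x \<in> B u. \<exists>y \<in> B v. (x, y) \<in> parcs G))"

subsection \<open>Rooted trees\<close>

text \<open>The predicates \<open>forest\<close> and \<open>tree\<close> of the library are not usable here: on symmetric
  digraphs they regard \<open>u, v, u\<close> as a cycle.\<close>

definition has_cycle :: "'a pair_pre_digraph \<Rightarrow> bool" where
  "has_cycle G \<longleftrightarrow> (\<exists>p. vpath p (with_proj G) \<and> length p \<ge> 3 \<and> (last p, hd p) \<in> parcs G)"

definition rooted_tree :: "'a pair_pre_digraph \<Rightarrow> 'a \<Rightarrow> bool" where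
  "rooted_tree T r \<longleftrightarrow>
    pair_graph T \<and> connected (with_proj T) \<and> \<not> has_cycle T \<and> r \<in> pverts T"

text \<open>The vertices of \<open>T\<^sub>x\<close>: those \<open>z\<close> for which \<open>x\<close> lies on the path from the root to \<open>z\<close>.\<close>

definition subtree_verts :: "'a pair_pre_digraph \<Rightarrow> 'a \<Rightarrow> 'a \<Rightarrow> 'a set" where
  "subtree_verts T r x =
    {z \<in> pverts T. \<exists>p. vpath p (with_proj T) \<and> hd p = r \<and> last p = z \<and> x \<in> set p}"

definition children :: "'a pair_pre_digraph \<Rightarrow> 'a \<Rightarrow> 'a \<Rightarrow> 'a set" where
  "children T r y = {x \<in> subtree_verts T r y. (y, x) \<in> parcs T}"

definition binary_tree :: "'a pair_pre_digraph \<Rightarrow> 'a \<Rightarrow> bool" where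
  "binary_tree T r \<longleftrightarrow> rooted_tree T r \<and> (\<forall>y \<in> pverts T. card (children T r y) \<le> 2)"

definition rooted_iso ::
    "'a pair_pre_digraph \<Rightarrow> 'a \<Rightarrow> 'b pair_pre_digraph \<Rightarrow> 'b \<Rightarrow> bool" where
  "rooted_iso T r S s \<longleftrightarrow>
    (\<exists>f. bij_betw f (pverts T) (pverts S) \<and> f r = s \<and>
      (\<forall>u \<in> pverts T. \<forall>v \<in> pverts T. (u, v) \<in> parcs T \<longleftrightarrow> (f u, f v) \<in> parcs S))"

subsection \<open>The graphs \<open>\<Gamma>\<^sub>m\<close>, \<open>\<Gamma>\<^sub>m\<^sup>+\<close> and \<open>\<nabla>\<^sub>m\<close>\<close>

text \<open>The vertices of \<open>\<Gamma>\<^sub>m\<close> are the bit strings of length at most \<open>m\<close>, the root is \<open>[]\<close>, and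
  the children of \<open>xs\<close> are the strings \<open>xs @ [b]\<close>. The leaves are the strings of length \<open>m\<close>.\<close>

definition Gamma :: "nat \<Rightarrow> bool list pair_pre_digraph" where
  "Gamma m =
    \<lparr> pverts = {xs. length xs \<le> m},
      parcs = {(xs, xs @ [b]) | xs b. length xs < m} \<union> {(xs @ [b], xs) | xs b. length xs < m} \<rparr>"

text \<open>\<^const>\<open>None\<close> is the vertex added to \<open>\<Gamma>\<^sub>m\<close>.\<close>

definition Gamma_plus :: "nat \<Rightarrow> bool list option pair_pre_digraph" where
  "Gamma_plus m =
    \<lparr> pverts = insert None (Some ` pverts (Gamma m)),
      parcs = map_prod Some Some ` parcs (Gamma m) \<union>
        {(None, Some xs) | xs. length xs = m} \<union> {(Some xs, None) | xs. length xs = m} \<rparr>"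

text \<open>\<open>\<nabla>\<^sub>n\<close> lives on \<open>{0..2^n}\<close> and has root edge \<open>{0, 2^n}\<close>. In the step, the two copies of
  \<open>\<nabla>\<^sub>n\<close> occupy \<open>{0..2^n}\<close> and \<open>{2^n..2^(n+1)}\<close>; they are glued to the triangle
  \<open>0, 2^n, 2^(n+1)\<close> along their root edges \<open>{0, 2^n}\<close> and \<open>{2^n, 2^(n+1)}\<close>, so that the only new
  edge is the third edge of the triangle. (Swapping the ends of a root edge does not matter, by
  the symmetry \<open>i \<mapsto> 2^n - i\<close> of \<open>\<nabla>\<^sub>n\<close>.) The recursion is started one step early, with
  \<open>\<nabla>\<^sub>0\<close> a single edge, so that \<open>\<nabla>\<^sub>1\<close> is the triangle.\<close>

primrec Nabla :: "nat \<Rightarrow> nat pair_pre_digraph" where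
  "Nabla 0 = \<lparr> pverts = {0, 1}, parcs = {(0, 1), (1, 0)} \<rparr>"
| "Nabla (Suc n) =
    \<lparr> pverts = pverts (Nabla n) \<union> (\<lambda>i. i + 2 ^ n) ` pverts (Nabla n),
      parcs = parcs (Nabla n) \<union> map_prod (\<lambda>i. i + 2 ^ n) (\<lambda>i. i + 2 ^ n) ` parcs (Nabla n) \<union>
        {(0, 2 ^ Suc n), (2 ^ Suc n, 0)} \<rparr>"

lemma Nabla_1:
  "Nabla 1 = \<lparr> pverts = {0, 1, 2}, parcs = {(0, 1), (1, 0), (1, 2), (2, 1), (0, 2), (2, 0)} \<rparr>"
  by (auto simp: numeral_2_eq_2)

lemma pverts_Nabla: "pverts (Nabla n) = {0..2 ^ n}"
proof (induction n)
  case (Suc n)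
  have "(\<lambda>i. i + 2 ^ n) ` {0..2 ^ n} = {2 ^ n..2 ^ Suc n :: nat}"
    by (simp add: image_add_atLeastAtMost' mult_2)
  with Suc show ?case
    by (auto simp: ivl_disj_un)
qed auto

lemma pair_graphI:
  assumes "finite (pverts G)" "parcs G \<subseteq> pverts G \<times> pverts G" "sym (parcs G)" "irrefl (parcs G)"
  shows "pair_graph G"
  using assms
  by unfold_locales
    (auto simp: symmetric_def irrefl_def arcs_ends_def arc_to_ends_def with_proj_def
      intro: finite_subset[of _ "pverts G \<times> pverts G"])

lemma sym_map_prod_image: "sym R \<Longrightarrow> sym (map_prod f f ` R)"
  unfolding sym_def by force

lemma pair_graph_Gamma: "pair_graph (Gamma m)"
proof (rule pair_graphI)
  show "finite (pverts (Gamma m))"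
    using finite_lists_length_le[of "UNIV :: bool set" m] by (simp add: Gamma_def)
qed (auto simp: Gamma_def sym_def irrefl_def)

lemma pair_graph_Gamma_plus: "pair_graph (Gamma_plus m)"
proof (rule pair_graphI)
  show "finite (pverts (Gamma_plus m))"
    using finite_lists_length_le[of "UNIV :: bool set" m] by (simp add: Gamma_plus_def Gamma_def)
  have "sym (map_prod Some Some ` parcs (Gamma m))"
    by (rule sym_map_prod_image) (auto simp: Gamma_def sym_def)
  moreover have "sym ({(None, Some xs) | xs :: bool list. length xs = m} \<union>
      {(Some xs, None) | xs. length xs = m})"
    by (auto simp: sym_def)
  ultimately show "sym (parcs (Gamma_plus m))"
    unfolding Gamma_plus_def by (simp add: sym_Un Un_assoc)
qed (auto simp: Gamma_plus_def Gamma_def irrefl_def)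

lemma pair_graph_Nabla: "pair_graph (Nabla n)"
proof (rule pair_graphI)
  have "parcs (Nabla n) \<subseteq> {0..2 ^ n} \<times> {0..2 ^ n} \<and> sym (parcs (Nabla n)) \<and> irrefl (parcs (Nabla n))"
  proof (induction n)
    case (Suc n)
    have "sym (parcs (Nabla (Suc n)))"
      unfolding Nabla.simps pair_pre_digraph.simps
      by (intro sym_Un sym_map_prod_image) (use Suc in \<open>auto simp: sym_def\<close>)
    with Suc show ?case
      by (fastforce simp: irrefl_def)
  qed (auto simp: sym_def irrefl_def)
  then show "parcs (Nabla n) \<subseteq> pverts (Nabla n) \<times> pverts (Nabla n)"
      "sym (parcs (Nabla n))" "irrefl (parcs (Nabla n))"
    by (auto simp: pverts_Nabla)
qed (simp add: pverts_Nabla)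

subsection \<open>Ears and binary ear trees\<close>

definition path_graph :: "'a list \<Rightarrow> 'a pair_pre_digraph" where
  "path_graph p = \<lparr> pverts = set p, parcs = set (vwalk_arcs p) \<union> (set (vwalk_arcs p))\<inverse> \<rparr>"

definition path_ends :: "'a list \<Rightarrow> 'a set" where
  "path_ends p = {hd p, last p}"

definition internal_verts :: "'a list \<Rightarrow> 'a set" where
  "internal_verts p = set p - path_ends p"

definition is_ear :: "'a pair_pre_digraph \<Rightarrow> 'a pair_pre_digraph \<Rightarrow> 'a list \<Rightarrow> bool" where
  "is_ear G H p \<longleftrightarrow>
    vpath p (with_proj G) \<and> path_ends p \<subseteq> pverts H \<and> internal_verts p \<inter> pverts H = {}"

definition binary_ear_tree ::
    "'a pair_pre_digraph \<Rightarrow> 'b pair_pre_digraph \<Rightarrow> 'b \<Rightarrow> ('b \<Rightarrow> 'a list) \<Rightarrow> bool" where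
  "binary_ear_tree G T r P \<longleftrightarrow>
    binary_tree T r \<and>
    (\<forall>x \<in> pverts T. vpath (P x) (with_proj G) \<and> vwalk_length (P x) \<ge> 2) \<and>
    (\<forall>y \<in> pverts T. \<forall>x \<in> children T r y.
      is_ear G (path_graph (P y)) (P x) \<and>
      internal_verts (P x) \<inter> (\<Union>z \<in> pverts T - subtree_verts T r x. set (P z)) = {})"

definition clean_ear_tree :: "'b pair_pre_digraph \<Rightarrow> 'b \<Rightarrow> ('b \<Rightarrow> 'a list) \<Rightarrow> bool" where
  "clean_ear_tree T r P \<longleftrightarrow>
    (\<forall>y \<in> pverts T. children T r y \<noteq> {} \<longrightarrow>
      (\<exists>e \<in> path_ends (P y). \<forall>x \<in> children T r y. e \<notin> set (P x)))"

end

theory Submission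
  imports Defs
begin

text \<open>
  Direct every path of the ear tree so that each child runs along its parent from left to right.
  The two children of a vertex then attach to its path either side by side, or along overlapping
  segments with the right end of the path free, or along overlapping segments with the left end
  free. Side by side, two models of \<open>\<nabla>\<^sub>k\<close> without the root edge combine to one of \<open>\<nabla>\<close> of index
  \<open>k + 1\<close>, the two root edges being supplied by the path of the parent. If the segments overlap,
  cut the path of the parent inside the overlap: the part with the free end becomes the root of a
  complete binary tree one level higher, and the other part joins the additional vertices of the
  two \<open>\<Gamma>\<^sub>k\<^sup>+\<close> below. Models also pass unchanged from a child to its parent, so a Ramsey-type induction
  shows that an ear tree of height \<open>a + b + c - 2\<close> contains \<open>\<nabla>\<close> of index \<open>a + 1\<close> without its root
  edge, or \<open>\<Gamma>\<^sub>b\<^sup>+\<close>, or \<open>\<Gamma>\<^sub>c\<^sup>+\<close>; the last two differ in which ends play the role of the additional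
  vertex.
\<close>

subsection \<open>Connected sets, paths and segments\<close>

text \<open>Half-open, so that cutting a path at an index gives disjoint segments, joined by the arc
  that enters the cut.\<close>

definition seg :: "'a list \<Rightarrow> nat \<Rightarrow> nat \<Rightarrow> 'a set" where
  "seg p i j = (!) p ` {i..<j}"

lemma nth_in_seg: "i \<le> k \<Longrightarrow> k < j \<Longrightarrow> p ! k \<in> seg p i j"
  by (auto simp: seg_def)

lemma seg_eq_empty: "j \<le> i \<Longrightarrow> seg p i j = {}"
  by (auto simp: seg_def)

lemma seg_subset_set: "j \<le> length p \<Longrightarrow> seg p i j \<subseteq> set p"
  by (auto simp: seg_def)

lemma nth_in_seg_iff:
  "distinct p \<Longrightarrow> k < length p \<Longrightarrow> j \<le> length p \<Longrightarrow> p ! k \<in> seg p i j \<longleftrightarrow> i \<le> k \<and> k < j"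
  by (auto simp: seg_def nth_eq_iff_index_eq)

lemma seg_subset: "j \<le> length p \<Longrightarrow> set p \<subseteq> U \<Longrightarrow> seg p i j \<subseteq> U"
  using seg_subset_set[of j p i] by blast

locale sym_arcs =
  fixes E :: "('a \<times> 'a) set"
  assumes sym_E: "sym E"
begin

definition conn :: "'a set \<Rightarrow> bool" where
  "conn S \<longleftrightarrow> S \<noteq> {} \<and> (\<forall>x \<in> S. \<forall>y \<in> S. (x, y) \<in> rtrancl_on S E)"

definition touches :: "'a set \<Rightarrow> 'a set \<Rightarrow> bool" where
  "touches A B \<longleftrightarrow> (\<exists>x \<in> A. \<exists>y \<in> B. (x, y) \<in> E)"

definition path :: "'a list \<Rightarrow> bool" where
  "path p \<longleftrightarrow> distinct p \<and> (\<forall>i. Suc i < length p \<longrightarrow> (p ! i, p ! Suc i) \<in> E)"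

lemma touchesI: "(x, y) \<in> E \<Longrightarrow> x \<in> A \<Longrightarrow> y \<in> B \<Longrightarrow> touches A B"
  unfolding touches_def by blast

lemma touches_sym: "touches A B \<Longrightarrow> touches B A"
  using sym_E unfolding touches_def sym_def by blast

lemma touches_mono: "touches A B \<Longrightarrow> A \<subseteq> A' \<Longrightarrow> B \<subseteq> B' \<Longrightarrow> touches A' B'"
  unfolding touches_def by blast

lemma conn_singleton: "conn {x}"
  by (auto simp: conn_def)

lemma rtrancl_on_superset: "(x, y) \<in> rtrancl_on A E \<Longrightarrow> A \<subseteq> B \<Longrightarrow> (x, y) \<in> rtrancl_on B E"
  by (rule rtrancl_on_mono[of E E A B]) auto

text \<open>Every vertex reaches \<open>x\<close> inside the union, passing through \<open>y\<close>
  if it lies outside \<open>A\<close>, and symmetry reverses these walks. The disjunction covers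
  both sets that meet and sets joined by an arc.\<close>

lemma conn_UnI:
  assumes "conn A" "conn B" "x \<in> A" "y \<in> B" "x = y \<or> (x, y) \<in> E"
  shows "conn (A \<union> B)"
proof -
  let ?R = "rtrancl_on (A \<union> B) E"
  have sym_R: "(b, a) \<in> ?R" if "(a, b) \<in> ?R" for a b
    using rtrancl_on_sym[OF sym_E] that by (meson symD)
  have xy: "(x, y) \<in> ?R"
    using assms(3-5) by (auto intro: rtrancl_on_into_rtrancl_on)
  have to_x: "(a, x) \<in> ?R" if "a \<in> A \<union> B" for a
  proof (cases "a \<in> A")
    case True
    then show ?thesis
      using assms(1,3) by (auto simp: conn_def intro: rtrancl_on_superset)
  next
    case False
    then have "(a, y) \<in> ?R"
      using that assms(2,4) by (auto simp: conn_def intro: rtrancl_on_superset)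
    then show ?thesis
      using sym_R[OF xy] rtrancl_on_trans by fast
  qed
  show ?thesis
    using assms(3) to_x sym_R unfolding conn_def by (blast intro: rtrancl_on_trans)
qed

lemma conn_Un_meet: "conn A \<Longrightarrow> conn B \<Longrightarrow> x \<in> A \<Longrightarrow> x \<in> B \<Longrightarrow> conn (A \<union> B)"
  by (rule conn_UnI[where x = x and y = x]) auto

lemma path_arcI: "path p \<Longrightarrow> Suc i < length p \<Longrightarrow> (p ! i, p ! Suc i) \<in> E"
  by (simp add: path_def)

lemma path_arc_predI: "path p \<Longrightarrow> 0 < i \<Longrightarrow> i < length p \<Longrightarrow> (p ! (i - 1), p ! i) \<in> E"
  using path_arcI[of p "i - 1"] by simp

lemma conn_seg:
  assumes "path p" "i < j" "j \<le> length p"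
  shows "conn (seg p i j)"
  using assms(2,3)
proof (induction j rule: less_induct)
  case (less j)
  then obtain k where k: "j = Suc k"
    by (cases j) auto
  show ?case
  proof (cases "i = k")
    case True
    then show ?thesis
      using k by (simp add: seg_def conn_singleton)
  next
    case False
    then have "conn (seg p i k)"
      using less k by auto
    moreover have "seg p i j = seg p i k \<union> {p ! k}"
      using less.prems k by (auto simp: seg_def atLeastLessThanSuc)
    moreover have "p ! (k - 1) \<in> seg p i k" "(p ! (k - 1), p ! k) \<in> E"
      using False less.prems k path_arc_predI[OF assms(1), of k] by (auto intro!: nth_in_seg)
    ultimately show ?thesis
      using conn_UnI[OF _ conn_singleton, of "seg p i k" "p ! (k - 1)" "p ! k"] by simp
  qed
qed

lemma path_rev: "path p \<Longrightarrow> path (rev p)"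
  unfolding path_def
proof (intro conjI allI impI)
  fix i
  assume p: "distinct p \<and> (\<forall>i. Suc i < length p \<longrightarrow> (p ! i, p ! Suc i) \<in> E)"
    and i: "Suc i < length (rev p)"
  \<comment> \<open>The arc of \<open>p\<close> that leaves position \<open>?k\<close> becomes,
    traversed backwards, the arc of \<open>rev p\<close> that leaves position
    \<open>i\<close>.\<close>
  let ?k = "length p - Suc (Suc i)"
  have "(p ! ?k, p ! Suc ?k) \<in> E"
    using p i by simp
  moreover have "Suc ?k = length p - Suc i"
    using i by simp
  ultimately show "(rev p ! i, rev p ! Suc i) \<in> E"
    using i sym_E by (auto simp: rev_nth sym_def)
qed simp

subsection \<open>Models\<close>

text \<open>A model of \<open>\<nabla>\<^sub>k\<close> without its root edge inside \<open>U\<close>; the branch sets of the ends of the root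
  edge contain the ends of \<open>p\<close>.\<close>

inductive nabla_model :: "nat \<Rightarrow> 'a list \<Rightarrow> 'a set \<Rightarrow> bool" for k p U where
  nabla_modelI: "\<lbrakk>\<And>i. B i \<subseteq> U;
    \<And>x i j. x \<in> B i \<Longrightarrow> x \<in> B j \<Longrightarrow> i = j;
    \<And>i. i \<le> 2 ^ k \<Longrightarrow> conn (B i);
    \<And>i j. (i, j) \<in> parcs (Nabla k) \<Longrightarrow> {i, j} \<noteq> {0, 2 ^ k} \<Longrightarrow> touches (B i) (B j);
    hd p \<in> B 0;
    last p \<in> B (2 ^ k)\<rbrakk>
    \<Longrightarrow> nabla_model k p U"

text \<open>A model of \<open>\<Gamma>\<^sub>k\<^sup>+\<close> inside \<open>U\<close>; the branch set of the additional vertex contains the first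
  vertex of \<open>p\<close>, while the last vertex of \<open>p\<close> is left out but touched by the branch set of the
  root.\<close>

inductive gamma_model :: "nat \<Rightarrow> 'a list \<Rightarrow> 'a set \<Rightarrow> bool" for k p U where
  gamma_modelI: "\<lbrakk>\<And>i. B i \<subseteq> U - {last p};
    \<And>x i j. x \<in> B i \<Longrightarrow> x \<in> B j \<Longrightarrow> i = j;
    conn (B None);
    \<And>xs :: bool list. length xs \<le> k \<Longrightarrow> conn (B (Some xs));
    \<And>xs b. length xs < k \<Longrightarrow> touches (B (Some xs)) (B (Some (xs @ [b])));
    \<And>xs. length xs = k \<Longrightarrow> touches (B None) (B (Some xs));
    hd p \<in> B None;
    touches (B (Some [])) {last p}\<rbrakk>
    \<Longrightarrow> gamma_model k p U"

text \<open>Children of a vertex of the ear tree attach to the path of their parent. The set \<open>U\<close> stands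
  for the union of the paths in the subtree of the child.\<close>

definition attached :: "'a list \<Rightarrow> 'a list \<Rightarrow> 'a set \<Rightarrow> nat \<Rightarrow> nat \<Rightarrow> bool" where
  "attached p q U u v \<longleftrightarrow> u < v \<and> v < length p \<and> hd q = p ! u \<and> last q = p ! v \<and>
    U \<inter> set p = {p ! u, p ! v}"

text \<open>Index \<open>i\<close> of \<open>p\<close> becomes \<open>length p - Suc i\<close>,
  which reverses the order of positions; reversing \<open>q\<close> as well keeps the child running
  from left to right.\<close>

lemma attached_rev:
  assumes "attached p q U u v" "q \<noteq> []"
  shows "attached (rev p) (rev q) U (length p - Suc v) (length p - Suc u)"
proof -
  have uv: "u < v" "v < length p" and q: "hd q = p ! u" "last q = p ! v"
    and U: "U \<inter> set p = {p ! u, p ! v}"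
    using assms(1) by (simp_all add: attached_def)
  have "rev p ! (length p - Suc i) = p ! i" if "i < length p" for i
    using that by (simp add: rev_nth Suc_diff_Suc)
  then have "rev p ! (length p - Suc v) = p ! v" "rev p ! (length p - Suc u) = p ! u"
    using uv by simp_all
  then show ?thesis
    using uv q U assms(2) by (auto simp: attached_def hd_rev last_rev)
qed

section \<open>Models on a single path\<close>

text \<open>Without its root edge, \<open>\<nabla>\<^sub>1\<close> is a path on three vertices. The
  first vertex, the interior and the last vertex of \<open>p\<close> serve as branch sets; the
  length bound makes the interior nonempty.\<close>

lemma nabla_model_path:
  assumes p: "path p" "length p \<ge> 3" "set p \<subseteq> U"
  shows "nabla_model (Suc 0) p U"
proof -
  let ?n = "length p"
  have hd: "hd p = p ! 0" and last: "last p = p ! (?n - 1)"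
    using p(2) by (cases "p = []"; simp add: hd_conv_nth last_conv_nth)+
  have d: "distinct p"
    using p(1) by (simp add: path_def)
  let ?B = "\<lambda>i::nat. if i = 0 then seg p 0 1 else if i = 1 then seg p 1 (?n - 1)
      else if i = 2 then seg p (?n - 1) ?n else {}"
  have sub: "?B i \<subseteq> set p" for i
    using p(2) by (simp add: seg_subset)
  have 1: "?B i \<subseteq> U" for i
    using sub[of i] p(3) by blast
  have 2: "i = j" if x: "x \<in> ?B i" "x \<in> ?B j" for x i j
  proof -
    obtain c where "x = p ! c" "c < ?n"
      using subsetD[OF sub x(1)] by (auto simp: in_set_conv_nth)
    then show ?thesis
      using x p(2) by (simp add: nth_in_seg_iff[OF d] split: if_splits)
  qed
  have 3: "conn (?B i)" if "i \<le> 2 ^ Suc 0" for i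
    using that p by (auto intro!: conn_seg)
  have "touches (?B 0) (?B 1)"
    by (rule touchesI[OF path_arcI[OF p(1), of 0]]) (use p(2) in \<open>auto intro!: nth_in_seg\<close>)
  moreover have "touches (?B 1) (?B 2)"
    by (rule touchesI[OF path_arc_predI[OF p(1), of "?n - 1"]])
      (use p(2) in \<open>auto intro!: nth_in_seg\<close>)
  ultimately have "touches (?B 0) (?B 1) \<and> touches (?B 1) (?B 0) \<and> touches (?B 1) (?B 2) \<and>
      touches (?B 2) (?B 1)"
    by (auto dest: touches_sym)
  then have 4: "touches (?B i) (?B j)" if "(i, j) \<in> parcs (Nabla (Suc 0))" "{i, j} \<noteq> {0, 2 ^ Suc 0}"
    for i j
    using that by (simp only: One_nat_def[symmetric] Nabla_1) auto
  have 5: "hd p \<in> ?B 0" "last p \<in> ?B (2 ^ Suc 0)"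
    using p(2) by (auto simp: hd last intro!: nth_in_seg)
  from 1 2 3 4 5 show ?thesis
    by (rule nabla_modelI)
qed

text \<open>\<open>\<Gamma>\<^sub>0\<^sup>+\<close> is a single edge. The first vertex of
  \<open>p\<close> is the additional vertex, and the interior of \<open>p\<close> is the root, which
  is also the only leaf.\<close>

lemma gamma_model_path:
  assumes p: "path p" "length p \<ge> 3" "set p \<subseteq> U"
  shows "gamma_model 0 p U"
proof -
  let ?n = "length p"
  have hd: "hd p = p ! 0" and last: "last p = p ! (?n - 1)"
    using p(2) by (cases "p = []"; simp add: hd_conv_nth last_conv_nth)+
  have d: "distinct p"
    using p(1) by (simp add: path_def)
  let ?B = "\<lambda>i. if i = None then seg p 0 1 else if i = Some [] then seg p 1 (?n - 1) else {}"
  have sub: "?B i \<subseteq> set p" for i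
    using p(2) by (simp add: seg_subset)
  have "last p \<notin> ?B i" for i
    using p(2) by (simp add: last nth_in_seg_iff[OF d])
  then have 1: "?B i \<subseteq> U - {last p}" for i
    using sub[of i] p(3) by blast
  have 2: "i = j" if x: "x \<in> ?B i" "x \<in> ?B j" for x i j
  proof -
    obtain c where "x = p ! c" "c < ?n"
      using subsetD[OF sub x(1)] by (auto simp: in_set_conv_nth)
    then show ?thesis
      using x p(2) by (simp add: nth_in_seg_iff[OF d] split: if_splits)
  qed
  have 4: "conn (?B (Some xs))" if "length xs \<le> 0" for xs
    using that p by (auto intro!: conn_seg)
  have 3: "conn (?B None)"
    using p by (auto intro!: conn_seg)
  have 5: "touches (?B None) (?B (Some xs))" if "length xs = 0" for xs
    by (rule touchesI[OF path_arcI[OF p(1), of 0]]) (use p(2) that in \<open>auto intro!: nth_in_seg\<close>)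
  have 6: "touches (?B (Some [])) {last p}"
    by (rule touchesI[OF path_arc_predI[OF p(1), of "?n - 1"]])
      (use p(2) in \<open>auto simp: last intro!: nth_in_seg\<close>)
  have 7: "hd p \<in> ?B None"
    using p(2) by (auto simp: hd intro!: nth_in_seg)
  have "touches (?B (Some xs)) (?B (Some (xs @ [b])))" if "length xs < 0" for xs b
    using that by simp
  from 1 2 3 4 this 5 7 6 show ?thesis
    by (rule gamma_modelI)
qed

text \<open>Here \<open>A\<close> will be segments of the parent path, and \<open>B\<close> and
  \<open>C\<close> the reindexed models of its two children. A vertex of both \<open>B i\<close> and
  \<open>C j\<close> lies in some \<open>A k\<close>, which forces \<open>i = k = j\<close>.\<close>

lemma glue_disjoint:
  assumes "\<And>x i j. x \<in> A i \<Longrightarrow> x \<in> A j \<Longrightarrow> i = j"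
    and "\<And>x i j. x \<in> B i \<Longrightarrow> x \<in> B j \<Longrightarrow> i = j"
    and "\<And>x i j. x \<in> C i \<Longrightarrow> x \<in> C j \<Longrightarrow> i = j"
    and "\<And>x i j. x \<in> B i \<Longrightarrow> x \<in> A j \<Longrightarrow> i = j"
    and "\<And>x i j. x \<in> C i \<Longrightarrow> x \<in> A j \<Longrightarrow> i = j"
    and "\<And>x i j. x \<in> B i \<Longrightarrow> x \<in> C j \<Longrightarrow> \<exists>k. x \<in> A k"
    and "x \<in> A i \<union> B i \<union> C i" "x \<in> A j \<union> B j \<union> C j"
  shows "i = j"
  using assms(7,8) assms(1-6)[of x] by (elim UnE) metis+

section \<open>Passing a model from a child to its parent\<close>

text \<open>The branch sets of the two root ends absorb the part of \<open>p\<close> up to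
  \<open>u\<close> and the part from \<open>v\<close> on; the part strictly between \<open>u\<close>
  and \<open>v\<close> is dropped.\<close>

lemma nabla_model_parent:
  assumes p: "path p" and att: "attached p q U u v" and sub: "U \<union> set p \<subseteq> W"
    and q: "nabla_model k q U"
  shows "nabla_model k p W"
proof -
  let ?n = "length p"
  from att have uv: "u < v" "v < ?n" "hd q = p ! u" "last q = p ! v"
    and U: "U \<inter> set p = {p ! u, p ! v}"
    by (auto simp: attached_def)
  have d: "distinct p"
    using p by (simp add: path_def)
  have hd: "hd p = p ! 0" and last: "last p = p ! (?n - 1)"
    using uv by (cases "p = []"; simp add: hd_conv_nth last_conv_nth)+
  from q show ?thesis
  proof cases
    case (nabla_modelI B)
    note BU = nabla_modelI(1) and disj = nabla_modelI(2) and conn = nabla_modelI(3)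
      and arcs = nabla_modelI(4) and ends = nabla_modelI(5,6)[unfolded uv]
    define A where "A = (\<lambda>i::nat. if i = 0 then seg p 0 (Suc u) else if i = 2 ^ k then seg p v ?n else {})"
    define C where "C = (\<lambda>i. A i \<union> B i)"
    have A_sub: "A i \<subseteq> set p" for i
      using uv by (simp add: A_def seg_subset)
    have A_nth: "p ! c \<in> A i \<longleftrightarrow> (i = 0 \<and> c \<le> u) \<or> (i = 2 ^ k \<and> v \<le> c)" if "c < ?n" for c i
      using that uv by (auto simp: A_def nth_in_seg_iff[OF d])
    have A_disj: "i = j" if x: "x \<in> A i" "x \<in> A j" for x i j
    proof -
      obtain c where "x = p ! c" "c < ?n"
        using subsetD[OF A_sub x(1)] by (auto simp: in_set_conv_nth)
      then show ?thesis
        using x uv A_nth[of c i] A_nth[of c j] by auto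
    qed
    \<comment> \<open>The model meets \<open>p\<close> only in \<open>p ! u\<close> and
      \<open>p ! v\<close>, which \<open>A\<close> and \<open>B\<close> place at the same indices
      \<open>0\<close> and \<open>2 ^ k\<close>.\<close>
    have AB: "i = j" if "x \<in> B i" "x \<in> A j" for x i j
    proof -
      have "x = p ! u \<or> x = p ! v"
        using that BU A_sub U by blast
      then show ?thesis
        using that ends disj A_disj A_nth[of u 0] A_nth[of v "2 ^ k"] uv by (metis order_refl order_less_trans)
    qed
    have "C i \<subseteq> W" for i
      using A_sub BU sub unfolding C_def by blast
    moreover have "i = j" if "x \<in> C i" "x \<in> C j" for x i j
      using that disj A_disj AB unfolding C_def by blast
    moreover have "conn (C i)" if "i \<le> 2 ^ k" for i
    proof -
      consider "i = 0" | "i = 2 ^ k" "i \<noteq> 0" | "i \<noteq> 0" "i \<noteq> 2 ^ k"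
        by auto
      then show ?thesis
      proof cases
        case 1
        have "conn (seg p 0 (Suc u) \<union> B 0)"
          by (rule conn_Un_meet[OF conn_seg conn nth_in_seg[of 0 u] ends(1)]) (use p uv in auto)
        then show ?thesis
          using 1 by (simp add: C_def A_def)
      next
        case 2
        have "conn (seg p v ?n \<union> B (2 ^ k))"
          by (rule conn_Un_meet[OF conn_seg conn nth_in_seg[of v v] ends(2)]) (use p uv in auto)
        then show ?thesis
          using 2 by (simp add: C_def A_def)
      next
        case 3
        then show ?thesis
          using conn that by (simp add: C_def A_def)
      qed
    qed
    moreover have "touches (C i) (C j)" if "(i, j) \<in> parcs (Nabla k)" "{i, j} \<noteq> {0, 2 ^ k}" for i j
      using arcs[OF that] by (rule touches_mono) (auto simp: C_def)
    moreover have "hd p \<in> C 0" "last p \<in> C (2 ^ k)"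
      using uv A_nth[of 0 0] A_nth[of "?n - 1" "2 ^ k"] by (cases "p = []"; auto simp: C_def hd last)+
    ultimately show ?thesis
      by (rule nabla_model.nabla_modelI)
  qed
qed

text \<open>The additional vertex absorbs the part of \<open>p\<close> up to \<open>u\<close>, and
  the root absorbs the part from \<open>v\<close> up to the vertex before
  \<open>last p\<close>.\<close>

lemma gamma_model_parent:
  assumes p: "path p" and att: "attached p q U u v" and sub: "U \<union> set p \<subseteq> W"
    and q: "gamma_model k q U"
  shows "gamma_model k p W"
proof -
  let ?n = "length p"
  from att have uv: "u < v" "v < ?n" "hd q = p ! u" "last q = p ! v"
    and U: "U \<inter> set p = {p ! u, p ! v}"
    by (auto simp: attached_def)
  have d: "distinct p"
    using p by (simp add: path_def)
  have hd: "hd p = p ! 0" and last: "last p = p ! (?n - 1)"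
    using uv by (cases "p = []"; simp add: hd_conv_nth last_conv_nth)+
  from q show ?thesis
  proof cases
    case (gamma_modelI B)
    note BU = gamma_modelI(1)[unfolded uv] and disj = gamma_modelI(2) and conn = gamma_modelI(3,4)
      and arcs = gamma_modelI(5,6) and ends = gamma_modelI(7,8)[unfolded uv]
    define A where "A = (\<lambda>i :: bool list option. if i = None then seg p 0 (Suc u)
      else if i = Some [] then seg p v (?n - 1) else {})"
    define C where "C = (\<lambda>i. A i \<union> B i)"
    have A_sub: "A i \<subseteq> set p" for i
      using uv by (simp add: A_def seg_subset)
    have A_nth: "p ! c \<in> A i \<longleftrightarrow> (i = None \<and> c \<le> u) \<or> (i = Some [] \<and> v \<le> c \<and> c < ?n - 1)"
      if "c < ?n" for c i
      using that uv by (auto simp: A_def nth_in_seg_iff[OF d])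
    have A_disj: "i = j" if x: "x \<in> A i" "x \<in> A j" for x i j
    proof -
      obtain c where "x = p ! c" "c < ?n"
        using subsetD[OF A_sub x(1)] by (auto simp: in_set_conv_nth)
      then show ?thesis
        using x uv A_nth[of c i] A_nth[of c j] by auto
    qed
    \<comment> \<open>The other attachment point \<open>p ! v\<close> is \<open>last q\<close>,
      which the model leaves out.\<close>
    have B_p: "x = p ! u" if "x \<in> B i" "x \<in> set p" for x i
      using that BU U by blast
    have AB: "i = j" if "x \<in> B i" "x \<in> A j" for x i j
    proof -
      have "x = p ! u"
        using that A_sub B_p by blast
      then show ?thesis
        using that ends disj A_disj A_nth[of u None] uv by (metis order_refl order_less_trans)
    qed
    have last_A: "last p \<notin> A i" for i
      using uv by (auto simp: last A_nth)
    have last_B: "last p \<notin> B i" for i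
      using B_p[of "last p" i] uv d by (auto simp: last nth_eq_iff_index_eq)
    \<comment> \<open>The root touches \<open>p ! v\<close>. If this is \<open>last p\<close>, it
      stays left out and nothing is added; otherwise it starts the segment that extends the root,
      and the last arc of \<open>p\<close> gives the new contact.\<close>
    have root: "conn (C (Some [])) \<and> touches (C (Some [])) {last p}"
    proof (cases "v = ?n - 1")
      case True
      then show ?thesis
        using conn(2)[of "[]"] ends(2) by (simp add: C_def A_def seg_eq_empty last)
    next
      case False
      obtain y where y: "y \<in> B (Some [])" "(y, p ! v) \<in> E"
        using ends(2) by (auto simp: touches_def)
      have "conn (B (Some []) \<union> seg p v (?n - 1))"
        by (rule conn_UnI[OF conn(2) conn_seg y(1) nth_in_seg[of v v]]) (use p uv y False in auto)
      moreover have "touches (C (Some [])) {last p}"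
        by (rule touchesI[OF path_arc_predI[OF p, of "?n - 1"]])
          (use uv False in \<open>auto simp: C_def A_def last intro!: nth_in_seg\<close>)
      ultimately show ?thesis
        by (simp add: C_def A_def Un_commute)
    qed
    have "C i \<subseteq> W - {last p}" for i
      using A_sub[of i] BU[of i] sub last_A last_B unfolding C_def by blast
    moreover have "i = j" if "x \<in> C i" "x \<in> C j" for x i j
      using that disj A_disj AB unfolding C_def by blast
    moreover have "conn (C None)"
    proof -
      have "conn (seg p 0 (Suc u) \<union> B None)"
        by (rule conn_Un_meet[OF conn_seg conn(1) nth_in_seg[of 0 u] ends(1)]) (use p uv in auto)
      then show ?thesis
        by (simp add: C_def A_def)
    qed
    moreover have "conn (C (Some xs))" if "length xs \<le> k" for xs
      using conn(2)[OF that] root by (cases "xs = []") (simp_all add: C_def A_def)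
    moreover have "touches (C (Some xs)) (C (Some (xs @ [b])))" if "length xs < k" for xs b
      using arcs(1)[OF that] by (rule touches_mono) (auto simp: C_def)
    moreover have "touches (C None) (C (Some xs))" if "length xs = k" for xs
      using arcs(2)[OF that] by (rule touches_mono) (auto simp: C_def)
    moreover have "hd p \<in> C None"
      using uv A_nth[of 0 None] by (cases "p = []") (auto simp: C_def hd)
    moreover have "touches (C (Some [])) {last p}"
      using root ..
    ultimately show ?thesis
      by (rule gamma_model.gamma_modelI)
  qed
qed

section \<open>Combining the models of two children\<close>

lemma parcs_Nabla_le:
  assumes "(i, j) \<in> parcs (Nabla k)"
  shows "i \<le> 2 ^ k \<and> j \<le> 2 ^ k"
proof -
  interpret pair_graph "Nabla k"
    by (rule pair_graph_Nabla)
  show ?thesis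
    using in_arcsD1[OF assms] in_arcsD2[OF assms] pverts_Nabla[of k] by simp
qed

text \<open>Cut \<open>p\<close> just before \<open>v\<close> and \<open>v'\<close>. The three
  pieces contain \<open>p ! u\<close>, both \<open>p ! v\<close> and \<open>p ! u'\<close>, and
  \<open>p ! v'\<close>, in this order, so they extend the branch sets of the vertices
  \<open>0\<close>, \<open>2 ^ k\<close> and \<open>2 ^ Suc k\<close>.\<close>

lemma nabla_model_step:
  assumes p: "path p"
    and att: "attached p q U u v" "attached p q' U' u' v'"
    and side: "v \<le> u'" and UU': "U \<inter> U' \<subseteq> set p" and sub: "U \<union> U' \<union> set p \<subseteq> W"
    and q: "nabla_model k q U" "nabla_model k q' U'"
  shows "nabla_model (Suc k) p W"
proof -
  let ?n = "length p" and ?K = "2 ^ k :: nat"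
  from att have uv: "u < v" "v < ?n" "hd q = p ! u" "last q = p ! v"
    and U: "U \<inter> set p = {p ! u, p ! v}"
    and uv': "u' < v'" "v' < ?n" "hd q' = p ! u'" "last q' = p ! v'"
    and U': "U' \<inter> set p = {p ! u', p ! v'}"
    by (auto simp: attached_def)
  have d: "distinct p"
    using p by (simp add: path_def)
  define A where "A = (\<lambda>i::nat. if i = 0 then seg p 0 v else if i = ?K then seg p v v'
      else if i = 2 * ?K then seg p v' ?n else {})"
  have A_sub: "A i \<subseteq> set p" for i
    using uv uv' by (simp add: A_def seg_subset)
  have A_nth: "p ! c \<in> A i \<longleftrightarrow> (i = 0 \<and> c < v) \<or> (i = ?K \<and> v \<le> c \<and> c < v') \<or> (i = 2 * ?K \<and> v' \<le> c)"
    if "c < ?n" for c i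
    using that uv uv' by (auto simp: A_def nth_in_seg_iff[OF d])
  have A_disj: "i = j" if x: "x \<in> A i" "x \<in> A j" for x i j
  proof -
    obtain c where "x = p ! c" "c < ?n"
      using subsetD[OF A_sub x(1)] by (auto simp: in_set_conv_nth)
    then show ?thesis
      using x uv uv' side A_nth[of c i] A_nth[of c j] by auto
  qed
  from q(1) show ?thesis
  proof cases
    case B: (nabla_modelI B)
    note ends = B(5,6)[unfolded uv]
    from q(2) show ?thesis
    proof cases
      case B': (nabla_modelI B')
      note ends' = B'(5,6)[unfolded uv']
      \<comment> \<open>The two copies share the index \<open>?K\<close>, where the right root end
        of the first model merges with the left root end of the second. The bounds discard sets of
        the first model beyond \<open>2 ^ k\<close>, about which little is known, and keep truncated
        subtraction from repeating \<open>B' 0\<close>.\<close>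
      define D where "D = (\<lambda>i. if i \<le> ?K then B i else {})"
      define D' where "D' = (\<lambda>i. if ?K \<le> i then B' (i - ?K) else {})"
      define C where "C = (\<lambda>i. A i \<union> D i \<union> D' i)"
      have D_sub: "D i \<subseteq> U" "D' i \<subseteq> U'" for i
        using B(1) B'(1) by (auto simp: D_def D'_def)
      have D_disj: "i = j" if "x \<in> D i" "x \<in> D j" for x i j
        using that B(2) by (auto simp: D_def split: if_splits)
      have D'_disj: "i = j" if "x \<in> D' i" "x \<in> D' j" for x i j
        using that B'(2)[of x "i - ?K" "j - ?K"] by (auto simp: D'_def split: if_splits)
      have D_ends: "p ! u \<in> D 0" "p ! v \<in> D ?K" "p ! u' \<in> D' ?K" "p ! v' \<in> D' (2 * ?K)"
        using ends ends' by (auto simp: D_def D'_def)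
      have A_ends: "p ! u \<in> A 0" "p ! v \<in> A ?K" "p ! u' \<in> A ?K" "p ! v' \<in> A (2 * ?K)"
        using uv uv' side by (auto simp: A_nth)
      have AD: "i = j" if "x \<in> D i" "x \<in> A j" for x i j
      proof -
        have "x = p ! u \<or> x = p ! v"
          using that D_sub(1)[of i] A_sub[of j] U by blast
        then show ?thesis
          using that D_disj A_disj D_ends A_ends by metis
      qed
      have AD': "i = j" if "x \<in> D' i" "x \<in> A j" for x i j
      proof -
        have "x = p ! u' \<or> x = p ! v'"
          using that D_sub(2)[of i] A_sub[of j] U' by blast
        then show ?thesis
          using that D'_disj A_disj D_ends A_ends by metis
      qed
      \<comment> \<open>The two models can meet only on \<open>p\<close>, and the three pieces cover
        \<open>p\<close>.\<close>
      have DD': "\<exists>l. x \<in> A l" if "x \<in> D i" "x \<in> D' j" for x i j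
      proof -
        have "x \<in> set p"
          using that D_sub UU' by blast
        then obtain c where "x = p ! c" "c < ?n"
          by (auto simp: in_set_conv_nth)
        then show ?thesis
          using A_nth[of c] by (metis linorder_not_le)
      qed
      have C_sub: "C i \<subseteq> W" for i
        using A_sub[of i] D_sub[of i] sub unfolding C_def by blast
      have C_disj: "i = j" if "x \<in> C i" "x \<in> C j" for x i j
        using A_disj D_disj D'_disj AD AD' DD' that[unfolded C_def] by (rule glue_disjoint)
      have C_conn: "conn (C i)" if "i \<le> 2 ^ Suc k" for i
      proof -
        have "i = 0 \<or> 0 < i \<and> i < ?K \<or> i = ?K \<or> ?K < i \<and> i < 2 * ?K \<or> i = 2 * ?K"
          using that unfolding power_Suc by linarith
        then consider "i = 0" | "0 < i" "i < ?K" | "i = ?K" | "?K < i" "i < 2 * ?K" | "i = 2 * ?K"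
          by blast
        then show ?thesis
        proof cases
          case 1
          have "conn (seg p 0 v \<union> B 0)"
            by (rule conn_Un_meet[OF conn_seg B(3) nth_in_seg[of 0 u] ends(1)]) (use p uv in auto)
          then show ?thesis
            using 1 by (simp add: C_def A_def D_def D'_def)
        next
          case 2
          then show ?thesis
            using B(3)[of i] by (simp add: C_def A_def D_def D'_def)
        next
          case 3
          have "conn (seg p v v' \<union> B ?K)"
            by (rule conn_Un_meet[OF conn_seg B(3) nth_in_seg[of v v] ends(2)])
              (use p uv uv' side in auto)
          then have "conn ((seg p v v' \<union> B ?K) \<union> B' 0)"
            by (rule conn_Un_meet[OF _ B'(3) _ ends'(1)])
              (use uv' side in \<open>auto intro!: nth_in_seg\<close>)
          then show ?thesis
            using 3 by (simp add: C_def A_def D_def D'_def)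
        next
          case 4
          then show ?thesis
            using B'(3)[of "i - ?K"] by (simp add: C_def A_def D_def D'_def)
        next
          case 5
          have "conn (seg p v' ?n \<union> B' ?K)"
            by (rule conn_Un_meet[OF conn_seg B'(3) nth_in_seg[of v' v'] ends'(2)])
              (use p uv' in auto)
          then show ?thesis
            using 5 by (simp add: C_def A_def D_def D'_def)
        qed
      qed
      \<comment> \<open>The arcs of \<open>p\<close> across the two cuts supply the root edges that
        the models of the children lack.\<close>
      have "touches (C 0) (C ?K)"
        by (rule touchesI[OF path_arc_predI[OF p, of v]])
          (use uv uv' side in \<open>auto simp: C_def A_nth\<close>)
      moreover have "touches (C ?K) (C (2 * ?K))"
        by (rule touchesI[OF path_arc_predI[OF p, of v']])
          (use uv uv' side in \<open>auto simp: C_def A_nth\<close>)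
      ultimately have root_arcs: "touches (C 0) (C ?K)" "touches (C ?K) (C 0)"
          "touches (C ?K) (C (2 * ?K))" "touches (C (2 * ?K)) (C ?K)"
        by (simp_all add: touches_sym)
      have C_arcs: "touches (C i) (C j)"
        if ij: "(i, j) \<in> parcs (Nabla (Suc k))" "{i, j} \<noteq> {0, 2 ^ Suc k}" for i j
      proof -
        consider "(i, j) \<in> parcs (Nabla k)"
          | i' j' where "i = i' + ?K" "j = j' + ?K" "(i', j') \<in> parcs (Nabla k)"
          using ij by auto
        then show ?thesis
        proof cases
          case 1
          show ?thesis
          proof (cases "{i, j} = {0, ?K}")
            case True
            then show ?thesis
              using root_arcs by (auto simp: doubleton_eq_iff)
          next
            case False
            show ?thesis
              by (rule touches_mono[OF B(4)[OF 1 False]])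
                (use parcs_Nabla_le[OF 1] in \<open>auto simp: C_def D_def\<close>)
          qed
        next
          case 2
          show ?thesis
          proof (cases "{i', j'} = {0, ?K}")
            case True
            then show ?thesis
              using root_arcs 2 by (auto simp: doubleton_eq_iff mult_2)
          next
            case False
            show ?thesis
              by (rule touches_mono[OF B'(4)[OF 2(3) False]]) (use 2 in \<open>auto simp: C_def D'_def\<close>)
          qed
        qed
      qed
      have "p \<noteq> []"
        using uv by auto
      then have C_ends: "hd p \<in> C 0" "last p \<in> C (2 ^ Suc k)"
        using uv uv' by (auto simp: C_def A_nth hd_conv_nth last_conv_nth)
      from C_sub C_disj C_conn C_arcs C_ends show ?thesis
        by (rule nabla_modelI)
    qed
  qed
qed

text \<open>The descendants of the child \<open>[b]\<close> of the root are the strings that start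
  with \<open>b\<close>, so the old root \<open>[]\<close> moves to \<open>[b]\<close>. The
  additional vertex keeps its index, so that those of two children can be merged.\<close>

definition below :: "bool \<Rightarrow> (bool list option \<Rightarrow> 'a set) \<Rightarrow> bool list option \<Rightarrow> 'a set" where
  "below b B i = (case i of None \<Rightarrow> B None | Some [] \<Rightarrow> {}
    | Some (c # xs) \<Rightarrow> if c = b then B (Some xs) else {})"

lemma below_simps [simp]:
  "below b B None = B None"
  "below b B (Some []) = {}"
  "below b B (Some (c # xs)) = (if c = b then B (Some xs) else {})"
  by (simp_all add: below_def)

lemma below_disjoint:
  assumes "\<And>x i j. x \<in> B i \<Longrightarrow> x \<in> B j \<Longrightarrow> i = j" "x \<in> below b B i" "x \<in> below b B j"
  shows "i = j"
  using assms(2,3) assms(1)[of x]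
  by (fastforce simp: below_def split: option.splits list.splits if_splits)

lemma below_subset: "(\<And>i. B i \<subseteq> U) \<Longrightarrow> below b B i \<subseteq> U"
  by (auto simp: below_def split: option.splits list.splits if_splits)

text \<open>A cut just before \<open>min v v'\<close> leaves \<open>p ! u\<close> and
  \<open>p ! u'\<close> on its left and \<open>p ! v\<close> and \<open>p ! v'\<close> on its right.
  The left piece joins the two additional vertices, and the right piece without
  \<open>last p\<close> is the new root; \<open>clean\<close> keeps both \<open>v\<close> and
  \<open>v'\<close> inside it.\<close>

lemma gamma_model_step:
  assumes p: "path p"
    and att: "attached p q U u v" "attached p q' U' u' v'"
    and overlap: "u < v'" "u' < v" and clean: "v < length p - 1" "v' < length p - 1"
    and UU': "U \<inter> U' \<subseteq> set p" and sub: "U \<union> U' \<union> set p \<subseteq> W"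
    and q: "gamma_model k q U" "gamma_model k q' U'"
  shows "gamma_model (Suc k) p W"
proof -
  let ?n = "length p"
  from att have uv: "u < v" "v < ?n" "hd q = p ! u" "last q = p ! v"
    and U: "U \<inter> set p = {p ! u, p ! v}"
    and uv': "u' < v'" "v' < ?n" "hd q' = p ! u'" "last q' = p ! v'"
    and U': "U' \<inter> set p = {p ! u', p ! v'}"
    by (auto simp: attached_def)
  have d: "distinct p"
    using p by (simp add: path_def)
  have hd: "hd p = p ! 0" and last: "last p = p ! (?n - 1)"
    using uv by (cases "p = []"; simp add: hd_conv_nth last_conv_nth)+
  define m where "m = min v v'"
  have m: "u < m" "u' < m" "m \<le> v" "m \<le> v'" "m < ?n - 1"
    using uv uv' overlap clean by (auto simp: m_def)
  define A where "A = (\<lambda>i :: bool list option. if i = None then seg p 0 m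
      else if i = Some [] then seg p m (?n - 1) else {})"
  have A_sub: "A i \<subseteq> set p" for i
    using m by (simp add: A_def seg_subset)
  have A_nth: "p ! c \<in> A i \<longleftrightarrow> (i = None \<and> c < m) \<or> (i = Some [] \<and> m \<le> c \<and> c < ?n - 1)"
    if "c < ?n" for c i
    using that m by (auto simp: A_def nth_in_seg_iff[OF d])
  have A_disj: "i = j" if x: "x \<in> A i" "x \<in> A j" for x i j
  proof -
    obtain c where "x = p ! c" "c < ?n"
      using subsetD[OF A_sub x(1)] by (auto simp: in_set_conv_nth)
    then show ?thesis
      using x A_nth[of c i] A_nth[of c j] by auto
  qed
  from q(1) show ?thesis
  proof cases
    case B: (gamma_modelI B)
    note ends = B(7,8)[unfolded uv]
    from q(2) show ?thesis
    proof cases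
      case B': (gamma_modelI B')
      note ends' = B'(7,8)[unfolded uv']
      define D where "D = below True B"
      define D' where "D' = below False B'"
      define C where "C = (\<lambda>i. A i \<union> D i \<union> D' i)"
      have D_sub: "D i \<subseteq> U - {p ! v}" "D' i \<subseteq> U' - {p ! v'}" for i
        using below_subset[of B, OF B(1)] below_subset[of B', OF B'(1)] uv uv'
        by (auto simp: D_def D'_def)
      have D_disj: "i = j" if "x \<in> D i" "x \<in> D j" for x i j
        using B(2) that[unfolded D_def] by (rule below_disjoint)
      have D'_disj: "i = j" if "x \<in> D' i" "x \<in> D' j" for x i j
        using B'(2) that[unfolded D'_def] by (rule below_disjoint)
      have ends_D: "p ! u \<in> D None" "p ! u' \<in> D' None"
        using ends ends' by (simp_all add: D_def D'_def)
      have ends_A: "p ! u \<in> A None" "p ! u' \<in> A None"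
        using m uv uv' by (simp_all add: A_nth)
      have D_p: "x = p ! u" if "x \<in> D i" "x \<in> set p" for x i
        using that D_sub(1)[of i] U by blast
      have D'_p: "x = p ! u'" if "x \<in> D' i" "x \<in> set p" for x i
        using that D_sub(2)[of i] U' by blast
      have AD: "i = j" if "x \<in> D i" "x \<in> A j" for x i j
        using that D_p[OF that(1)] A_sub D_disj A_disj ends_D ends_A by (metis subsetD)
      have AD': "i = j" if "x \<in> D' i" "x \<in> A j" for x i j
        using that D'_p[OF that(1)] A_sub D'_disj A_disj ends_D ends_A by (metis subsetD)
      have DD': "\<exists>l. x \<in> A l" if "x \<in> D i" "x \<in> D' j" for x i j
      proof -
        have "x \<in> set p"
          using that D_sub(1)[of i] D_sub(2)[of j] UU' by blast
        then show ?thesis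
          using D_p[OF that(1)] ends_A by blast
      qed
      have "last p \<in> set p"
        using uv by (simp add: last)
      then have last_D: "last p \<notin> D i" "last p \<notin> D' i" for i
        using D_p[of "last p" i] D'_p[of "last p" i] m d uv uv'
        by (auto simp: last nth_eq_iff_index_eq)
      have last_A: "last p \<notin> A i" for i
        using uv m by (simp add: last A_nth)
      have C_sub: "C i \<subseteq> W - {last p}" for i
        using A_sub[of i] D_sub[of i] sub last_D[of i] last_A[of i] unfolding C_def by blast
      have C_disj: "i = j" if "x \<in> C i" "x \<in> C j" for x i j
        using A_disj D_disj D'_disj AD AD' DD' that[unfolded C_def] by (rule glue_disjoint)
      have C_None: "conn (C None)"
      proof -
        have "conn (seg p 0 m \<union> B None)"
          by (rule conn_Un_meet[OF conn_seg B(3) nth_in_seg[of 0 u] ends(1)]) (use p m in auto)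
        then have "conn ((seg p 0 m \<union> B None) \<union> B' None)"
          by (rule conn_Un_meet[OF _ B'(3) _ ends'(1)]) (use m in \<open>auto intro!: nth_in_seg\<close>)
        then show ?thesis
          by (simp add: C_def A_def D_def D'_def)
      qed
      have C_root: "C (Some []) = seg p m (?n - 1)"
        by (simp add: C_def A_def D_def D'_def)
      have C_Cons: "C (Some (c # xs)) = (if c then B (Some xs) else B' (Some xs))" for c xs
        by (simp add: C_def A_def D_def D'_def)
      have C_conn: "conn (C (Some xs))" if "length xs \<le> Suc k" for xs
        using that B(4) B'(4) conn_seg[OF p, of m "?n - 1"] m
        by (cases xs) (simp_all add: C_root C_Cons)
      have C_arcs: "touches (C (Some xs)) (C (Some (xs @ [b])))" if "length xs < Suc k" for xs b
      proof (cases xs)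
        case Nil
        \<comment> \<open>The models of the children leave out \<open>p ! v\<close> and
          \<open>p ! v'\<close> but touch them from their roots; these vertices now belong to the
          new root.\<close>
        have "touches {p ! v} (B (Some []))" "touches {p ! v'} (B' (Some []))"
          using ends(2) ends'(2) touches_sym by blast+
        moreover have "p ! v \<in> seg p m (?n - 1)" "p ! v' \<in> seg p m (?n - 1)"
          using m clean by (auto intro!: nth_in_seg)
        ultimately show ?thesis
          using Nil by (auto simp: C_root C_Cons intro: touches_mono)
      next
        case (Cons c ys)
        then show ?thesis
          using that B(5)[of ys b] B'(5)[of ys b] by (simp add: C_Cons)
      qed
      have C_leaf: "touches (C None) (C (Some xs))" if len: "length xs = Suc k" for xs
      proof -
        obtain c ys where xs: "xs = c # ys" "length ys = k"
          using len by (cases xs) auto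
        have "B None \<subseteq> C None" "B' None \<subseteq> C None"
          by (auto simp: C_def D_def D'_def)
        then show ?thesis
          using xs B(6)[of ys] B'(6)[of ys] by (auto simp: C_Cons intro: touches_mono)
      qed
      have C_hd: "hd p \<in> C None"
        using uv m A_nth[of 0 None] by (cases "p = []") (auto simp: C_def hd)
      have C_last: "touches (C (Some [])) {last p}"
        by (rule touchesI[OF path_arc_predI[OF p, of "?n - 1"]])
          (use m in \<open>auto simp: C_root last intro!: nth_in_seg\<close>)
      from C_sub C_disj C_None C_conn C_arcs C_leaf C_hd C_last show ?thesis
        by (rule gamma_modelI)
    qed
  qed
qed

subsection \<open>Consistently directed ear trees\<close>

text \<open>\<open>ears h p U\<close> holds if \<open>p\<close> is the path at the root of a clean ear tree that is complete of
  height \<open>h\<close>, where \<open>U\<close> is the union of the paths of the ear tree. All paths are directed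
  consistently: a child runs along its parent from left to right.\<close>

inductive ears :: "nat \<Rightarrow> 'a list \<Rightarrow> 'a set \<Rightarrow> bool" where
  leaf: "path p \<Longrightarrow> length p \<ge> 3 \<Longrightarrow> ears 0 p (set p)"
| node: "path p \<Longrightarrow> length p \<ge> 3 \<Longrightarrow> ears h q U \<Longrightarrow> ears h q' U' \<Longrightarrow>
    attached p q U u v \<Longrightarrow> attached p q' U' u' v' \<Longrightarrow> U \<inter> U' \<subseteq> set p \<Longrightarrow>
    hd p \<notin> U \<union> U' \<or> last p \<notin> U \<union> U' \<Longrightarrow> ears (Suc h) p (set p \<union> U \<union> U')"

lemma ears_not_Nil: "ears h p U \<Longrightarrow> p \<noteq> []"
  by (induction rule: ears.induct) auto

text \<open>All paths of the ear tree are reversed together, and the condition on a free end is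
  symmetric in the two ends. This redirects a child that runs from right to left.\<close>

lemma ears_rev: "ears h p U \<Longrightarrow> ears h (rev p) U"
proof (induction rule: ears.induct)
  case (leaf p)
  then show ?case
    using ears.leaf[of "rev p"] path_rev by simp
next
  case (node p h q U q' U' u v u' v')
  have "ears (Suc h) (rev p) (set (rev p) \<union> U \<union> U')"
    using node.hyps(2) node.IH path_rev[OF node.hyps(1)]
      attached_rev[OF node.hyps(5) ears_not_Nil[OF node.hyps(3)]]
      attached_rev[OF node.hyps(6) ears_not_Nil[OF node.hyps(4)]] node.hyps(7,8)
    by (intro ears.node) (auto simp: hd_rev last_rev)
  then show ?case
    by simp
qed

section \<open>The Ramsey-type induction\<close>

lemma attached_last_notin:
  assumes "attached p q U u v" "last p \<notin> U"
  shows "v < length p - 1"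
proof -
  have "p ! v \<in> U" "v < length p"
    using assms(1) by (auto simp: attached_def)
  moreover have "last p = p ! (length p - 1)"
    using \<open>v < length p\<close> by (cases "p = []") (simp_all add: last_conv_nth)
  ultimately show ?thesis
    using assms(2) by (metis Suc_diff_1 less_SucE list.size(3) length_greater_0_conv not_less_zero)
qed

text \<open>The way the children attach selects one of \<open>a\<close>, \<open>b\<close>,
  \<open>c\<close> to be lowered by one, which pays for the loss of one level. If both children have
  the model for the lowered parameter, the two combine; otherwise some child has a model of another
  kind with its parameter unchanged, and this passes to the parent.\<close>

lemma ears_model:
  assumes "ears h p U" "a + b + c \<le> h + 2"
  shows "nabla_model (Suc a) p U \<or> gamma_model b p U \<or> gamma_model c (rev p) U"
  using assms
proof (induction arbitrary: a b c rule: ears.induct)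
  case (leaf p)
  \<comment> \<open>At height \<open>0\<close> the sum is at most \<open>2\<close>, so some
    parameter vanishes and the path alone is a model.\<close>
  then have "a = 0 \<or> b = 0 \<or> c = 0"
    by linarith
  then show ?case
    using nabla_model_path[of p] gamma_model_path[of p] gamma_model_path[of "rev p"] path_rev leaf
    by auto
next
  case (node p h q U q' U' u v u' v')
  let ?W = "set p \<union> U \<union> U'" and ?n = "length p"
  note p = \<open>path p\<close> and att = \<open>attached p q U u v\<close> and att' = \<open>attached p q' U' u' v'\<close>
  note ra = attached_rev[OF att ears_not_Nil[OF \<open>ears h q U\<close>]]
    and ra' = attached_rev[OF att' ears_not_Nil[OF \<open>ears h q' U'\<close>]]
  have uv: "u < v" "v < ?n" "u' < v'" "v' < ?n"
    using att att' by (auto simp: attached_def)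
  have UU': "U \<inter> U' \<subseteq> set p" "U' \<inter> U \<subseteq> set p"
    using node.hyps(7) by auto
  have lift: "nabla_model i p ?W" if "nabla_model i q U \<or> nabla_model i q' U'" for i
    using that nabla_model_parent[OF p att, of ?W] nabla_model_parent[OF p att', of ?W] by auto
  have lift_g: "gamma_model i p ?W" if "gamma_model i q U \<or> gamma_model i q' U'" for i
    using that gamma_model_parent[OF p att, of ?W] gamma_model_parent[OF p att', of ?W] by auto
  have lift_r: "gamma_model i (rev p) ?W"
    if "gamma_model i (rev q) U \<or> gamma_model i (rev q') U'" for i
    using that gamma_model_parent[OF path_rev[OF p] ra, of ?W]
      gamma_model_parent[OF path_rev[OF p] ra', of ?W] by auto
  consider "a = 0 \<or> b = 0 \<or> c = 0" | "a > 0" "b > 0" "c > 0" "v \<le> u' \<or> v' \<le> u"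
    | "a > 0" "b > 0" "c > 0" "u < v'" "u' < v"
    by linarith
  then show ?case
  proof cases
    case 1
    then show ?thesis
      using nabla_model_path[of p ?W] gamma_model_path[of p ?W] gamma_model_path[of "rev p" ?W]
        path_rev node.hyps(1,2) by auto
  next
    case 2
    then obtain a' where a: "a = Suc a'"
      by (cases a) auto
    have "nabla_model (Suc a') q U \<or> gamma_model b q U \<or> gamma_model c (rev q) U"
      using node.prems a by (intro node.IH) simp
    moreover have "nabla_model (Suc a') q' U' \<or> gamma_model b q' U' \<or> gamma_model c (rev q') U'"
      using node.prems a by (intro node.IH) simp
    moreover have "nabla_model (Suc a) p ?W"
      if "nabla_model (Suc a') q U" "nabla_model (Suc a') q' U'"
      using 2(4)
    proof
      assume "v \<le> u'"
      then show ?thesis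
        using nabla_model_step[OF p att att' _ UU'(1) _ that, of ?W] a by auto
    next
      assume "v' \<le> u"
      then show ?thesis
        using nabla_model_step[OF p att' att _ UU'(2) _ that(2,1), of ?W] a by auto
    qed
    ultimately show ?thesis
      using lift_g lift_r by blast
  next
    case 3
    from node.hyps(8) show ?thesis
    proof
      assume "last p \<notin> U \<union> U'"
      then have clean: "v < ?n - 1" "v' < ?n - 1"
        using attached_last_notin[OF att] attached_last_notin[OF att'] by auto
      obtain b' where b: "b = Suc b'"
        using 3 by (cases b) auto
      have "nabla_model (Suc a) q U \<or> gamma_model b' q U \<or> gamma_model c (rev q) U"
        using node.prems b by (intro node.IH) simp
      moreover have "nabla_model (Suc a) q' U' \<or> gamma_model b' q' U' \<or> gamma_model c (rev q') U'"
        using node.prems b by (intro node.IH) simp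
      moreover have "gamma_model b p ?W" if "gamma_model b' q U" "gamma_model b' q' U'"
        using gamma_model_step[OF p att att' 3(4,5) clean UU'(1) _ that, of ?W] b by auto
      ultimately show ?thesis
        using lift lift_r by blast
    next
      \<comment> \<open>Reversal makes the free left end the last vertex, so the same combination
        applies to \<open>rev p\<close> and uses up one unit of \<open>c\<close>.\<close>
      assume "hd p \<notin> U \<union> U'"
      then have "last (rev p) \<notin> U \<union> U'"
        using node.hyps(2) by (cases "p = []") (auto simp: last_rev)
      then have clean: "?n - Suc u < length (rev p) - 1" "?n - Suc u' < length (rev p) - 1"
        using attached_last_notin[OF ra] attached_last_notin[OF ra'] by auto
      have ov: "?n - Suc v < ?n - Suc u'" "?n - Suc v' < ?n - Suc u"
        using 3 uv by auto
      obtain c' where c: "c = Suc c'"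
        using 3 by (cases c) auto
      have "nabla_model (Suc a) q U \<or> gamma_model b q U \<or> gamma_model c' (rev q) U"
        using node.prems c by (intro node.IH) simp
      moreover have "nabla_model (Suc a) q' U' \<or> gamma_model b q' U' \<or> gamma_model c' (rev q') U'"
        using node.prems c by (intro node.IH) simp
      moreover have "gamma_model c (rev p) ?W"
        if "gamma_model c' (rev q) U" "gamma_model c' (rev q') U'"
        using gamma_model_step[OF path_rev[OF p] ra ra' ov clean _ _ that, of ?W] UU'(1) c by auto
      ultimately show ?thesis
        using lift lift_g by blast
    qed
  qed
qed

section \<open>Directing the paths of an ear tree labelled by bit strings\<close>

definition subtree_union :: "nat \<Rightarrow> (bool list \<Rightarrow> 'a list) \<Rightarrow> bool list \<Rightarrow> 'a set" where
  "subtree_union m Q xs = (\<Union>ys \<in> {ys. length (xs @ ys) \<le> m}. set (Q (xs @ ys)))"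

lemma subtree_union_leaf: "length xs = m \<Longrightarrow> subtree_union m Q xs = set (Q xs)"
  by (auto simp: subtree_union_def)

lemma subtree_union_node:
  assumes "length xs < m"
  shows "subtree_union m Q xs =
    set (Q xs) \<union> subtree_union m Q (xs @ [True]) \<union> subtree_union m Q (xs @ [False])" (is "?L = ?R")
proof
  show "?L \<subseteq> ?R"
  proof
    fix x
    assume "x \<in> ?L"
    then obtain ys where ys: "length (xs @ ys) \<le> m" "x \<in> set (Q (xs @ ys))"
      by (auto simp: subtree_union_def)
    show "x \<in> ?R"
    proof (cases ys)
      case Nil
      then show ?thesis
        using ys by simp
    next
      case (Cons b zs)
      then have "x \<in> subtree_union m Q (xs @ [b])"
        using ys by (auto simp: subtree_union_def intro!: bexI[of _ zs])
      then show ?thesis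
        by (cases b) auto
    qed
  qed
  have "subtree_union m Q (xs @ [b]) \<subseteq> ?L" for b
    by (auto simp: subtree_union_def) (metis append_Cons append_Nil length_Cons add_Suc_right)
  moreover have "set (Q xs) \<subseteq> ?L"
    using assms by (auto simp: subtree_union_def intro!: exI[of _ "[]"])
  ultimately show "?R \<subseteq> ?L"
    by blast
qed

text \<open>Induction from the leaves upwards. The path at \<open>xs\<close> keeps its direction,
  while a child found to run along it from right to left is reversed together with its whole
  subtree.\<close>

lemma ears_of_labelled_paths:
  fixes Q :: "bool list \<Rightarrow> 'a list"
  assumes Q: "\<And>xs. length xs \<le> m \<Longrightarrow> path (Q xs) \<and> length (Q xs) \<ge> 3"
    and ends: "\<And>xs b. length xs < m \<Longrightarrow> path_ends (Q (xs @ [b])) \<subseteq> set (Q xs)"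
    and internal: "\<And>xs b zs. length xs < m \<Longrightarrow> length zs \<le> m \<Longrightarrow> \<nexists>ys. zs = (xs @ [b]) @ ys \<Longrightarrow>
      internal_verts (Q (xs @ [b])) \<inter> set (Q zs) = {}"
    and clean: "\<And>xs. length xs < m \<Longrightarrow> \<exists>e \<in> path_ends (Q xs). \<forall>b. e \<notin> set (Q (xs @ [b]))"
    and "length xs \<le> m"
  shows "ears (m - length xs) (Q xs) (subtree_union m Q xs)"
  using \<open>length xs \<le> m\<close>
proof (induction "m - length xs" arbitrary: xs)
  case 0
  then show ?case
    using Q[of xs] ears.leaf[of "Q xs"] by (simp add: subtree_union_leaf)
next
  case (Suc h)
  then have len: "length xs < m"
    by simp
  let ?p = "Q xs" and ?U = "\<lambda>b. subtree_union m Q (xs @ [b])"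
  \<comment> \<open>A vertex shared with a path outside the subtree at \<open>xs @ [b]\<close> is
    internal to no path inside it. It is therefore always an end, hence on the parent path, and
    climbs until it is an end of the path at \<open>xs @ [b]\<close>.\<close>
  have outside: "x \<in> path_ends (Q (xs @ [b]))"
    if "x \<in> ?U b" "x \<in> set (Q zs)" "length zs \<le> m" "\<nexists>ys. zs = (xs @ [b]) @ ys" for x b zs
  proof -
    have "x \<in> path_ends (Q (xs @ [b]))"
      if "length (xs @ [b] @ ys) \<le> m" "x \<in> set (Q (xs @ [b] @ ys))" for ys
      using that
    proof (induction ys rule: rev_induct)
      case Nil
      then show ?case
        using internal[OF len \<open>length zs \<le> m\<close>, of b] \<open>\<nexists>ys. zs = (xs @ [b]) @ ys\<close>
          \<open>x \<in> set (Q zs)\<close>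
        by (auto simp: internal_verts_def)
    next
      case (snoc c ys)
      let ?ys = "xs @ [b] @ ys"
      have l: "length ?ys < m"
        using snoc.prems by simp
      have "\<nexists>ws. zs = (?ys @ [c]) @ ws"
        using \<open>\<nexists>ys. zs = (xs @ [b]) @ ys\<close> by auto
      then have "internal_verts (Q (?ys @ [c])) \<inter> set (Q zs) = {}"
        by (rule internal[OF l \<open>length zs \<le> m\<close>])
      then have "x \<in> path_ends (Q (?ys @ [c]))"
        using snoc.prems \<open>x \<in> set (Q zs)\<close> by (auto simp: internal_verts_def)
      then have "x \<in> set (Q ?ys)"
        using ends[OF l, of c] by blast
      then show ?case
        using snoc.IH l by simp
    qed
    then show ?thesis
      using \<open>x \<in> ?U b\<close> by (auto simp: subtree_union_def)
  qed
  have nonempty: "Q ys \<noteq> []" if "length ys \<le> m" for ys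
    using Q[OF that] by auto
  have on_p: "?U b \<inter> set ?p = path_ends (Q (xs @ [b]))" for b
  proof
    show "?U b \<inter> set ?p \<subseteq> path_ends (Q (xs @ [b]))"
      using outside[of _ b xs] len by auto
    have "set (Q (xs @ [b])) \<subseteq> ?U b"
      using len by (auto simp: subtree_union_def intro!: exI[of _ "[]"])
    moreover have "path_ends (Q (xs @ [b])) \<subseteq> set (Q (xs @ [b]))"
      using nonempty[of "xs @ [b]"] len by (auto simp: path_ends_def)
    ultimately show "path_ends (Q (xs @ [b])) \<subseteq> ?U b \<inter> set ?p"
      using ends[OF len, of b] by blast
  qed
  have child: "\<exists>q u v. ears h q (?U b) \<and> attached ?p q (?U b) u v" for b
  proof -
    let ?q = "Q (xs @ [b])"
    have "ears (m - length (xs @ [b])) ?q (?U b)"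
      by (rule Suc.hyps(1)) (use Suc.hyps(2) in auto)
    moreover have "m - length (xs @ [b]) = h"
      using Suc.hyps(2) by simp
    ultimately have e: "ears h ?q (?U b)"
      by simp
    obtain i j where i: "i < length ?p" "hd ?q = ?p ! i" and j: "j < length ?p" "last ?q = ?p ! j"
      using ends[OF len, of b] by (auto simp: path_ends_def in_set_conv_nth)
    have "hd ?q \<noteq> last ?q"
    proof -
      have "distinct ?q" "length ?q \<ge> 3"
        using Q[of "xs @ [b]"] len by (auto simp: path_def)
      then show ?thesis
        by (cases ?q) auto
    qed
    \<comment> \<open>The order of the attachment points on the parent decides whether the subtree
      of the child is reversed.\<close>
    then consider "i < j" | "j < i"
      using i j by fastforce
    then show ?thesis
    proof cases
      case 1
      then have "attached ?p ?q (?U b) i j"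
        using i j on_p[of b] by (auto simp: attached_def path_ends_def)
      then show ?thesis
        using e by blast
    next
      case 2
      then have "attached ?p (rev ?q) (?U b) j i"
        using i j on_p[of b] ears_not_Nil[OF e]
        by (auto simp: attached_def path_ends_def hd_rev last_rev)
      then show ?thesis
        using ears_rev[OF e] by blast
    qed
  qed
  obtain q u v where q: "ears h q (?U True)" "attached ?p q (?U True) u v"
    using child by blast
  obtain q' u' v' where q': "ears h q' (?U False)" "attached ?p q' (?U False) u' v'"
    using child by blast
  have "?U True \<inter> ?U False \<subseteq> set ?p"
  proof
    fix x
    assume x: "x \<in> ?U True \<inter> ?U False"
    then obtain ys where "length ((xs @ [False]) @ ys) \<le> m" "x \<in> set (Q ((xs @ [False]) @ ys))"
      unfolding subtree_union_def by blast
    then have "x \<in> path_ends (Q (xs @ [True]))"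
      using x by (intro outside[of x True]) auto
    then show "x \<in> set ?p"
      using ends[OF len] by blast
  qed
  moreover have "hd ?p \<notin> ?U True \<union> ?U False \<or> last ?p \<notin> ?U True \<union> ?U False"
  proof -
    obtain e where e: "e \<in> path_ends ?p" "\<And>b. e \<notin> set (Q (xs @ [b]))"
      using clean[OF len] by blast
    \<comment> \<open>Cleanness mentions only the paths of the children, but their whole subtrees
      meet \<open>?p\<close> only in the ends of those paths.\<close>
    have "e \<notin> ?U b" for b
    proof
      assume "e \<in> ?U b"
      moreover have "e \<in> set ?p"
        using e(1) nonempty[of xs] len by (auto simp: path_ends_def)
      ultimately have "e \<in> path_ends (Q (xs @ [b]))"
        using on_p[of b] by blast
      then show False
        using e(2)[of b] nonempty[of "xs @ [b]"] len by (auto simp: path_ends_def)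
    qed
    then show ?thesis
      using e(1) by (auto simp: path_ends_def)
  qed
  ultimately have "ears (Suc h) ?p (set ?p \<union> ?U True \<union> ?U False)"
    using Q[of xs] len q q' by (intro ears.node) auto
  then show ?case
    using Suc.hyps(2) by (simp add: subtree_union_node[OF len])
qed

end

subsection \<open>Minors from models\<close>

lemma sym_arcs_parcs: "pair_graph G \<Longrightarrow> sym_arcs (parcs G)"
proof
  assume "pair_graph G"
  then interpret pair_graph G .
  show "sym (parcs G)"
    using sym_arcs by (simp add: symmetric_def)
qed

text \<open>\<open>connected\<close> means reachability in the symmetric closure of the induced
  subgraph, which contains every arc of \<open>G\<close> inside \<open>S\<close>.\<close>

lemma connected_if_conn:
  assumes "pair_graph G" "sym_arcs.conn (parcs G) S"
  shows "connected (with_proj G \<restriction> S)"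
proof -
  interpret sym_arcs "parcs G"
    by (rule sym_arcs_parcs[OF assms(1)])
  let ?M = "mk_symmetric (with_proj G \<restriction> S)"
  have "(x, y) \<in> rtrancl_on S (parcs ?M)" if "(x, y) \<in> rtrancl_on S (parcs G)" for x y
    using that
  proof (induction rule: rtrancl_on_induct)
    case (step y z)
    then have "(y, z) \<in> parcs ?M"
      by (force simp: parcs_mk_symmetric)
    then show ?case
      using step by (auto intro: rtrancl_on_into_rtrancl_on)
  qed auto
  then show ?thesis
    using assms(2) by (simp add: connected_def strongly_connected_def conn_def reachable_def)
qed

text \<open>The first half of \<open>\<nabla>\<^sub>l\<^sub>+\<^sub>1\<close>, on
  \<open>{0..2 ^ l}\<close>, is a full copy of \<open>\<nabla>\<^sub>l\<close> that avoids the root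
  edge missing from the model.\<close>

lemma is_minor_Nabla:
  assumes G: "pair_graph G" and U: "U \<subseteq> pverts G"
    and M: "sym_arcs.nabla_model (parcs G) (Suc l) p U"
  shows "is_minor (Nabla l) G"
proof -
  interpret sym_arcs "parcs G"
    by (rule sym_arcs_parcs[OF G])
  from M show ?thesis
  proof cases
    case B: (nabla_modelI B)
    have le: "i \<le> 2 ^ Suc l" if "i \<le> 2 ^ l" for i :: nat
      using that by simp
    have "touches (B i) (B j)" if "(i, j) \<in> parcs (Nabla l)" for i j
    proof (rule B(4))
      show "(i, j) \<in> parcs (Nabla (Suc l))"
        using that by simp
      have "(2::nat) ^ l < 2 ^ Suc l"
        by simp
      then show "{i, j} \<noteq> {0, 2 ^ Suc l}"
        using parcs_Nabla_le[OF that] by (auto simp: doubleton_eq_iff)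
    qed
    then show ?thesis
      unfolding is_minor_def pverts_Nabla
      using B(1,2) connected_if_conn[OF G B(3)[OF le]] U
      by (intro exI[of _ B]) (fastforce simp: touches_def)
  qed
qed

lemma is_minor_Gamma_plus:
  assumes G: "pair_graph G" and U: "U \<subseteq> pverts G"
    and M: "sym_arcs.gamma_model (parcs G) l p U"
  shows "is_minor (Gamma_plus l) G"
proof -
  interpret sym_arcs "parcs G"
    by (rule sym_arcs_parcs[OF G])
  from M show ?thesis
  proof cases
    case B: (gamma_modelI B)
    have verts: "B i \<subseteq> pverts G \<and> connected (with_proj G \<restriction> B i)" if "i \<in> pverts (Gamma_plus l)" for i
    proof -
      have "conn (B i)"
        using that B(3,4) by (auto simp: Gamma_plus_def Gamma_def)
      then show ?thesis
        using B(1)[of i] U connected_if_conn[OF G] by blast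
    qed
    have "touches (B i) (B j)" if "(i, j) \<in> parcs (Gamma_plus l)" for i j
      using that B(5,6) touches_sym by (fastforce simp: Gamma_plus_def Gamma_def)
    then have arcs: "\<exists>x \<in> B i. \<exists>y \<in> B j. (x, y) \<in> parcs G" if "(i, j) \<in> parcs (Gamma_plus l)" for i j
      using that unfolding touches_def by blast
    have "B i \<inter> B j = {}" if "i \<noteq> j" for i j
      using B(2) that by blast
    then show ?thesis
      unfolding is_minor_def using verts arcs by (intro exI[of _ B]) auto
  qed
qed

subsection \<open>Subtrees of complete binary trees\<close>

lemma set_vwalk_arcs: "set (vwalk_arcs p) = {(p ! i, p ! Suc i) | i. Suc i < length p}"
proof (induction p rule: vwalk_arcs.induct)
  case (3 x y xs)
  have "{(p ! i, p ! Suc i) | i. Suc i < length p} =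
      insert (x, y) {((y # xs) ! i, (y # xs) ! Suc i) | i. Suc i < length (y # xs)}"
    if "p = x # y # xs" for p
  proof (intro equalityI subsetI)
    fix e
    assume "e \<in> {(p ! i, p ! Suc i) | i. Suc i < length p}"
    then obtain i where i: "e = (p ! i, p ! Suc i)" "Suc i < length p"
      by blast
    then show "e \<in> insert (x, y) {((y # xs) ! i, (y # xs) ! Suc i) | i. Suc i < length (y # xs)}"
      using that by (cases i) auto
  next
    fix e
    assume "e \<in> insert (x, y) {((y # xs) ! i, (y # xs) ! Suc i) | i. Suc i < length (y # xs)}"
    then consider "e = (x, y)"
      | i where "e = ((y # xs) ! i, (y # xs) ! Suc i)" "Suc i < length (y # xs)"
      by blast
    then show "e \<in> {(p ! i, p ! Suc i) | i. Suc i < length p}"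
    proof cases
      case 1
      then show ?thesis
        using that by (auto intro!: exI[of _ 0])
    next
      case (2 i)
      then show ?thesis
        using that by (auto intro!: exI[of _ "Suc i"])
    qed
  qed
  then show ?case
    using 3 by simp
qed auto

lemma vpath_with_proj_iff:
  "vpath p (with_proj G) \<longleftrightarrow> p \<noteq> [] \<and> distinct p \<and> set p \<subseteq> pverts G \<and>
    (\<forall>i. Suc i < length p \<longrightarrow> (p ! i, p ! Suc i) \<in> parcs G)"
  by (auto simp: vpath_def vwalk_def set_vwalk_arcs)

text \<open>The isomorphism \<open>f\<close> names tree vertices by bit strings, so that subtrees
  become sets of extensions of a string.\<close>

locale complete_tree =
  fixes T :: "'b pair_pre_digraph" and r :: 'b and m :: nat and f :: "'b \<Rightarrow> bool list"
  assumes bij: "bij_betw f (pverts T) {xs. length xs \<le> m}" and root: "f r = []" "r \<in> pverts T"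
    and arc_iff: "u \<in> pverts T \<Longrightarrow> v \<in> pverts T \<Longrightarrow> (u, v) \<in> parcs T \<longleftrightarrow> (f u, f v) \<in> parcs (Gamma m)"
begin

definition vert :: "bool list \<Rightarrow> 'b" where
  "vert = inv_into (pverts T) f"

lemma vert: "length xs \<le> m \<Longrightarrow> vert xs \<in> pverts T \<and> f (vert xs) = xs"
  using bij bij_betw_imp_surj_on[OF bij]
  by (auto simp: vert_def intro: inv_into_into f_inv_into_f)

lemma vert_f: "x \<in> pverts T \<Longrightarrow> vert (f x) = x"
  using bij by (simp add: vert_def bij_betw_def)

text \<open>A path that starts at the root never goes back up, as it would revisit its previous vertex.\<close>

lemma path_from_root:
  assumes p: "vpath p (with_proj T)" "hd p = r" and "i < length p"
  shows "length (f (p ! i)) = i \<and> (\<forall>j \<le> i. f (p ! j) = take j (f (p ! i)))"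
  using \<open>i < length p\<close>
proof (induction i)
  case 0
  then show ?case
    using p root by (simp add: hd_conv_nth[symmetric])
next
  case (Suc i)
  then have IH: "length (f (p ! i)) = i" "\<And>j. j \<le> i \<Longrightarrow> f (p ! j) = take j (f (p ! i))"
    using Suc_lessD by blast+
  have T: "set p \<subseteq> pverts T" "distinct p" "(p ! i, p ! Suc i) \<in> parcs T"
    using p(1) Suc.prems by (auto simp: vpath_with_proj_iff)
  then have pT: "p ! j \<in> pverts T" if "j \<le> Suc i" for j
    using that Suc.prems by auto
  have "(f (p ! i), f (p ! Suc i)) \<in> parcs (Gamma m)"
    using arc_iff pT T(3) by simp
  then consider b where "f (p ! Suc i) = f (p ! i) @ [b]" | b where "f (p ! i) = f (p ! Suc i) @ [b]"
    by (auto simp: Gamma_def)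
  then show ?case
  proof cases
    case (1 b)
    have take_eq: "f (p ! j) = take j (f (p ! Suc i))" if "j \<le> Suc i" for j
    proof (cases "j = Suc i")
      case True
      then show ?thesis
        using 1 IH(1) by simp
    next
      case False
      then show ?thesis
        using that 1 IH(1) IH(2)[of j] by simp
    qed
    have "length (f (p ! Suc i)) = Suc i"
      using 1 IH(1) by simp
    then show ?thesis
      using take_eq by blast
  next
    case (2 b)
    then have i: "i = Suc (length (f (p ! Suc i)))"
      using IH(1) by simp
    then have "f (p ! (i - 1)) = f (p ! Suc i)"
      using IH(2)[of "i - 1"] 2 by simp
    then have "p ! (i - 1) = p ! Suc i"
      using pT vert_f by (metis diff_le_self le_Suc_eq order_refl le_SucI)
    then show ?thesis
      using T(2) Suc.prems by (simp add: nth_eq_iff_index_eq)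
  qed
qed

text \<open>A path from the root to \<open>z\<close> runs through the prefixes of \<open>f z\<close>
  in order, and \<open>x\<close> lies on it.\<close>

lemma subtree_vertsD:
  assumes "z \<in> subtree_verts T r x"
  shows "\<exists>ys. f z = f x @ ys"
proof -
  obtain p where p: "vpath p (with_proj T)" "hd p = r" "last p = z" "x \<in> set p"
    using assms by (auto simp: subtree_verts_def)
  obtain j where j: "j < length p" "x = p ! j"
    using p(4) by (auto simp: in_set_conv_nth)
  have "z = p ! (length p - 1)"
    using p(3) j by (cases "p = []") (auto simp: last_conv_nth)
  moreover have "f (p ! j) = take j (f (p ! (length p - 1)))"
  proof -
    have "length p - 1 < length p" "j \<le> length p - 1"
      using j by auto
    then show ?thesis
      using path_from_root[OF p(1,2)] by blast
  qed
  ultimately have "f x = take j (f z)"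
    using j by simp
  then show ?thesis
    by (metis append_take_drop_id)
qed

lemma vert_in_subtree_verts:
  assumes "length (xs @ ys) \<le> m"
  shows "vert (xs @ ys) \<in> subtree_verts T r (vert xs)"
proof -
  let ?zs = "xs @ ys"
  \<comment> \<open>The witness visits the prefixes of \<open>?zs\<close> by increasing length;
    \<open>vert xs\<close> sits at position \<open>length xs\<close>.\<close>
  define p where "p = map (\<lambda>i. vert (take i ?zs)) [0..<Suc (length ?zs)]"
  have len: "length p = Suc (length ?zs)"
    by (simp add: p_def)
  have nth: "p ! i = vert (take i ?zs)" if "i \<le> length ?zs" for i
    using that by (simp add: p_def del: upt_Suc)
  have f_nth: "p ! i \<in> pverts T \<and> f (p ! i) = take i ?zs" if "i \<le> length ?zs" for i
    using nth[OF that] vert[of "take i ?zs"] assms by simp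
  have "distinct p"
  proof (subst distinct_conv_nth, intro allI impI)
    fix i j
    assume ij: "i < length p" "j < length p" "i \<noteq> j"
    then have "length (f (p ! i)) = i" "length (f (p ! j)) = j"
      using f_nth len by (auto simp: min_def)
    then show "p ! i \<noteq> p ! j"
      using ij(3) by auto
  qed
  moreover have "set p \<subseteq> pverts T"
    using f_nth len by (auto simp: in_set_conv_nth)
  moreover have "(p ! i, p ! Suc i) \<in> parcs T" if "Suc i < length p" for i
  proof -
    have "take (Suc i) ?zs = take i ?zs @ [?zs ! i]"
      using that len by (intro take_Suc_conv_app_nth) simp
    moreover have "length (take i ?zs) < m"
      using that len assms by simp
    ultimately have "(take i ?zs, take (Suc i) ?zs) \<in> parcs (Gamma m)"
      unfolding Gamma_def by auto
    then show ?thesis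
      using arc_iff f_nth[of i] f_nth[of "Suc i"] that len by simp
  qed
  moreover have "p \<noteq> []"
    using len by auto
  ultimately have "vpath p (with_proj T)"
    by (simp add: vpath_with_proj_iff)
  moreover have "hd p = r"
    using \<open>p \<noteq> []\<close> nth[of 0] vert_f[OF root(2)] root(1) by (simp add: hd_conv_nth)
  moreover have "last p = vert ?zs"
    using \<open>p \<noteq> []\<close> nth[of "length ?zs"] len by (simp add: last_conv_nth)
  moreover have "vert xs \<in> set p"
    using nth[of "length xs"] len by (auto simp: in_set_conv_nth intro!: exI[of _ "length xs"])
  ultimately show ?thesis
    using vert assms by (auto simp: subtree_verts_def)
qed

lemma vert_snoc_in_children:
  assumes "length xs < m"
  shows "vert (xs @ [b]) \<in> children T r (vert xs)"
proof -
  have "(xs, xs @ [b]) \<in> parcs (Gamma m)"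
    using assms by (auto simp: Gamma_def)
  then show ?thesis
    using vert_in_subtree_verts[of xs "[b]"] vert[of xs] vert[of "xs @ [b]"] assms arc_iff
    by (auto simp: children_def)
qed

end

theorem theorem3p1:
  fixes G :: "'a pair_pre_digraph" and T :: "'b pair_pre_digraph" and r :: 'b
    and P :: "'b \<Rightarrow> 'a list" and l :: nat
  assumes "l \<ge> 1"
    and "pair_graph G"
    and "binary_ear_tree G T r P"
    and "clean_ear_tree T r P"
    and "rooted_iso T r (Gamma (3 * l - 2)) []"
  shows "is_minor (Gamma_plus l) G \<or> is_minor (Nabla l) G"
proof -
  define m where "m = 3 * l - 2"
  interpret sym_arcs "parcs G"
    by (rule sym_arcs_parcs[OF assms(2)])
  have r: "r \<in> pverts T"
    using assms(3) by (simp add: binary_ear_tree_def binary_tree_def rooted_tree_def)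
  obtain f where f: "bij_betw f (pverts T) (pverts (Gamma m))" "f r = []"
      "\<forall>u \<in> pverts T. \<forall>v \<in> pverts T. (u, v) \<in> parcs T \<longleftrightarrow> (f u, f v) \<in> parcs (Gamma m)"
    using assms(5) by (auto simp: rooted_iso_def m_def)
  interpret complete_tree T r m f
    by unfold_locales (use f r in \<open>auto simp: Gamma_def\<close>)
  let ?Q = "\<lambda>xs. P (vert xs)"
  have Q: "vpath (?Q xs) (with_proj G)" "length (?Q xs) \<ge> 3" if "length xs \<le> m" for xs
    using assms(3) vert[OF that] by (auto simp: binary_ear_tree_def)
  have ear: "is_ear G (path_graph (?Q xs)) (?Q (xs @ [b]))"
    "internal_verts (?Q (xs @ [b])) \<inter>
      (\<Union>z \<in> pverts T - subtree_verts T r (vert (xs @ [b])). set (P z)) = {}"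
    if "length xs < m" for xs b
  proof -
    have "vert xs \<in> pverts T"
      using vert that by simp
    then show "is_ear G (path_graph (?Q xs)) (?Q (xs @ [b]))"
      "internal_verts (?Q (xs @ [b])) \<inter>
        (\<Union>z \<in> pverts T - subtree_verts T r (vert (xs @ [b])). set (P z)) = {}"
      using assms(3) vert_snoc_in_children[OF that, of b] unfolding binary_ear_tree_def by blast+
  qed
  have "ears (m - length ([] :: bool list)) (?Q []) (subtree_union m ?Q [])"
  proof (rule ears_of_labelled_paths[where Q = ?Q])
    show "path (?Q xs) \<and> length (?Q xs) \<ge> 3" if "length xs \<le> m" for xs
      using Q[OF that] by (simp add: path_def vpath_with_proj_iff)
    show "path_ends (?Q (xs @ [b])) \<subseteq> set (?Q xs)" if "length xs < m" for xs b
      using ear(1)[OF that] by (simp add: is_ear_def path_graph_def)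
    show "internal_verts (?Q (xs @ [b])) \<inter> set (?Q zs) = {}"
      if "length xs < m" "length zs \<le> m" "\<nexists>ys. zs = (xs @ [b]) @ ys" for xs b zs
    proof -
      \<comment> \<open>By \<open>subtree_vertsD\<close>, membership would make \<open>zs\<close> an
        extension of \<open>xs @ [b]\<close>.\<close>
      have "vert zs \<notin> subtree_verts T r (vert (xs @ [b]))"
        using subtree_vertsD[of "vert zs" "vert (xs @ [b])"] vert[of zs] vert[of "xs @ [b]"] that
        by auto
      then show ?thesis
        using ear(2)[OF that(1), of b] vert[OF that(2)] by blast
    qed
    show "\<exists>e \<in> path_ends (?Q xs). \<forall>b. e \<notin> set (?Q (xs @ [b]))" if "length xs < m" for xs
    proof -
      have "vert xs \<in> pverts T" "children T r (vert xs) \<noteq> {}"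
        using vert[of xs] vert_snoc_in_children[OF that] that by auto
      then show ?thesis
        using assms(4) vert_snoc_in_children[OF that] unfolding clean_ear_tree_def by blast
    qed
  qed simp
  \<comment> \<open>All three parameters are \<open>l\<close>, and the height
    \<open>3 * l - 2\<close> meets the bound exactly; \<open>l \<ge> 1\<close> makes the subtraction
    genuine.\<close>
  moreover have "l + l + l \<le> m - length ([] :: bool list) + 2"
    using assms(1) by (simp add: m_def)
  ultimately have "nabla_model (Suc l) (?Q []) (subtree_union m ?Q []) \<or>
      gamma_model l (?Q []) (subtree_union m ?Q []) \<or> gamma_model l (rev (?Q [])) (subtree_union m ?Q [])"
    by (rule ears_model)
  moreover have "subtree_union m ?Q [] \<subseteq> pverts G"
    using Q(1) by (auto simp: subtree_union_def vpath_with_proj_iff)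
  ultimately show ?thesis
    using is_minor_Nabla[OF assms(2)] is_minor_Gamma_plus[OF assms(2)] by blast
qed

end
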